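(* Let $\mathbb{F}\in\{\mathbb{R},\mathbb{C}\}$ and $n\ge 2$. Let $X,Y\in \mathrm{GL}(n,\mathbb{F})$ and let $X_i$ and $Y_i$ denote the $i$th column of $X$ and $Y$, respectively. Let $S\subset\mathbb{F}^{n\times n}$ be a vector space over $\mathbb{F}$ with a basis $\mathcal{B}\subset\{X_iY_j^*\}_{1\le i,j\le n}$ such that $\max_{M\in S}\operatorname{rank} M=r$. Then there exist index sets $I,J\subset\{1,\dots,n\}$ with $|I|+|J|=2n-r$ such that $M\in S$ implies $(X^{-1}MY^{-*})_{I,J}=0$.
   Context: $Y_j^*$ denotes the conjugate transpose of $Y_j$ (transpose if $\mathbb{F}=\mathbb{R}$), and $Y^{-*}$ denotes the conjugate transpose of $Y^{-1}$. For a matrix $N$ and index sets $I,J$, $N_{I,J}$ denotes the submatrix of $N$ formed by keeping the rows indexed by $I$ and the columns indexed by $J$ (if $I$ or $J$ is empty, the condition $N_{I,J}=0$ is vacuous). *)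

theory Defs
  imports "HOL-Analysis.Analysis"
begin

definition conj_transpose :: "complex^'n^'m \<Rightarrow> complex^'m^'n" where
  "conj_transpose A = transpose (map_matrix cnj A)"

(* The library's span, subspace and independent on complex^'n^'m are those of the
   real vector space, so linear algebra over the complex scalars needs its own
   scalar multiplication. *)
definition cmat_scale :: "complex \<Rightarrow> complex^'n^'m \<Rightarrow> complex^'n^'m" where
  "cmat_scale c A = map_matrix (\<lambda>x. c * x) A"

interpretation cmat: vector_space "cmat_scale :: complex \<Rightarrow> complex^'n^'m \<Rightarrow> complex^'n^'m"
  by unfold_locales (auto simp: cmat_scale_def vec_eq_iff algebra_simps)

end

theory Submission
  imports Defs
begin

text \<open>
  Conjugating by \<open>X\<inverse>\<close> and \<open>Y\<^sup>-\<^sup>*\<close> turns \<open>X\<^sub>i Y\<^sub>j\<^sup>*\<close> into the matrix unit \<open>E\<^sub>i\<^sub>j\<close>, so \<open>S\<close> becomes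
  the space of all matrices supported on a set \<open>E\<close> of positions. Regard \<open>E\<close> as the edge set of a
  bipartite graph. The sum of the units over a matching has rank equal to the size of the matching,
  so every matching has at most \<open>r\<close> edges. By Koenig's theorem \<open>E\<close> is covered by some rows \<open>C\<close> and
  columns \<open>D\<close> with \<open>|C| + |D| \<le> r\<close>, and the complements of \<open>C\<close> and \<open>D\<close> index a zero block, which
  may be shrunk to the required size.
\<close>

section \<open>Vertex covers and matchings in bipartite graphs\<close>

definition edge_cover :: "('a \<times> 'b) set \<Rightarrow> 'a set \<Rightarrow> 'b set \<Rightarrow> bool" where
  "edge_cover E C D \<longleftrightarrow> (\<forall>(a, b)\<in>E. a \<in> C \<or> b \<in> D)"

lemma edge_cover_converse: "edge_cover (E\<inverse>) D C \<longleftrightarrow> edge_cover E C D"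
  unfolding edge_cover_def by auto

text \<open>If either cover contains \<open>x\<close>, it already covers the restored edge.
  Otherwise the two covers are uncrossed: union on the side of \<open>x\<close>, with
  \<open>x\<close> added, goes with intersection on the other side, and vice versa. Both results
  cover \<open>E\<close>.\<close>

lemma edge_cover_uncross:
  fixes E :: "('a \<times> 'b) set"
  assumes e: "(x, y) \<in> E" and f: "(x, z) \<in> E" and "y \<noteq> z"
    and fin: "finite C1" "finite D1" "finite C2" "finite D2"
    and cov1: "edge_cover (E - {(x, y)}) C1 D1" and k1: "card C1 + card D1 < k"
    and cov2: "edge_cover (E - {(x, z)}) C2 D2" and k2: "card C2 + card D2 < k"
  shows "\<exists>C D. finite C \<and> finite D \<and> edge_cover E C D \<and> card C + card D < k"
proof (cases "x \<in> C1 \<or> x \<in> C2")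
  case True
  then have "edge_cover E C1 D1 \<or> edge_cover E C2 D2"
    using cov1 cov2 unfolding edge_cover_def by auto
  then show ?thesis
    using fin k1 k2 by blast
next
  case False
  \<comment> \<open>The edge to \<open>z\<close> survives the deletion of the edge to
    \<open>y\<close>, and conversely, so each must be covered at its far end.\<close>
  then have "z \<in> D1" "y \<in> D2"
    using cov1 cov2 e f \<open>y \<noteq> z\<close> unfolding edge_cover_def by auto
  then have cov: "edge_cover E (insert x (C1 \<union> C2)) (D1 \<inter> D2)" "edge_cover E (C1 \<inter> C2) (D1 \<union> D2)"
    using cov1 cov2 unfolding edge_cover_def by auto
  have "card (insert x (C1 \<union> C2)) \<le> Suc (card (C1 \<union> C2))"
    by (rule card_insert_le_m1) auto
  moreover have "card (C1 \<union> C2) + card (C1 \<inter> C2) = card C1 + card C2"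
    "card (D1 \<union> D2) + card (D1 \<inter> D2) = card D1 + card D2"
    using fin by (simp_all flip: card_Un_Int)
  \<comment> \<open>The two sizes add up to at most \<open>2 * (k - 1) + 1\<close>, so they cannot
    both reach \<open>k\<close>.\<close>
  ultimately have "card (insert x (C1 \<union> C2)) + card (D1 \<inter> D2) < k \<or>
      card (C1 \<inter> C2) + card (D1 \<union> D2) < k"
    using k1 k2 by linarith
  then show ?thesis
    using cov fin by (meson finite_Int finite_UnI finite_insert)
qed

text \<open>In an edge set that is minimal with cover number \<open>k\<close>, two edges sharing a vertex would
  contradict uncrossing, so the edge set is itself a matching.\<close>

theorem koenig_bipartite:
  fixes E :: "('a \<times> 'b) set"
  assumes "finite E"
    and "\<And>C D. finite C \<Longrightarrow> finite D \<Longrightarrow> edge_cover E C D \<Longrightarrow> k \<le> card C + card D"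
  shows "\<exists>F\<subseteq>E. inj_on fst F \<and> inj_on snd F \<and> k \<le> card F"
  using assms
proof (induction E rule: finite_psubset_induct)
  case (psubset E)
  show ?case
  proof (cases "\<exists>e\<in>E. \<forall>C D. finite C \<longrightarrow> finite D \<longrightarrow> edge_cover (E - {e}) C D \<longrightarrow> k \<le> card C + card D")
    case True
    then obtain e where "e \<in> E"
      and "\<forall>C D. finite C \<longrightarrow> finite D \<longrightarrow> edge_cover (E - {e}) C D \<longrightarrow> k \<le> card C + card D"
      by blast
    with psubset.IH[of "E - {e}"] have "\<exists>F\<subseteq>E - {e}. inj_on fst F \<and> inj_on snd F \<and> k \<le> card F"
      by blast
    then show ?thesis
      by blast
  next
    case False
    then have small: "\<exists>C D. finite C \<and> finite D \<and> edge_cover (E - {e}) C D \<and> card C + card D < k"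
      if "e \<in> E" for e
      using that by (meson not_le)
    have "inj_on fst E"
    proof (rule inj_onI, rule ccontr)
      fix e f assume ef: "e \<in> E" "f \<in> E" "fst e = fst f" "e \<noteq> f"
      then obtain x y z where "e = (x, y)" "f = (x, z)" "y \<noteq> z"
        by (metis prod.collapse)
      then show False
        using small[OF ef(1)] small[OF ef(2)] ef(1,2) psubset.prems edge_cover_uncross[of x y E z]
        by (metis not_le)
    qed
    moreover have "inj_on snd E"
    proof (rule inj_onI, rule ccontr)
      fix e f assume ef: "e \<in> E" "f \<in> E" "snd e = snd f" "e \<noteq> f"
      then obtain x y z where xyz: "e = (y, x)" "f = (z, x)" "y \<noteq> z"
        by (metis prod.collapse)
      have conv: "(E - {(a, b)})\<inverse> = E\<inverse> - {(b, a)}" for a b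
        by auto
      obtain C1 D1 C2 D2 where c:
        "finite C1" "finite D1" "edge_cover (E - {e}) C1 D1" "card C1 + card D1 < k"
        "finite C2" "finite D2" "edge_cover (E - {f}) C2 D2" "card C2 + card D2 < k"
        using small[OF ef(1)] small[OF ef(2)] by blast
      \<comment> \<open>Uncrossing is stated for a shared first coordinate; a shared second
        coordinate is handled by exchanging the two sides.\<close>
      have "edge_cover (E\<inverse> - {(x, y)}) D1 C1" "edge_cover (E\<inverse> - {(x, z)}) D2 C2"
        using c(3,7) xyz by (simp_all flip: conv add: edge_cover_converse)
      then have "\<exists>D C. finite D \<and> finite C \<and> edge_cover (E\<inverse>) D C \<and> card D + card C < k"
        using c ef(1,2) xyz by (intro edge_cover_uncross[of x y "E\<inverse>" z]) auto
      then show False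
        using psubset.prems by (metis add.commute edge_cover_converse not_le)
    qed
    \<comment> \<open>The first endpoints cover \<open>E\<close>, and injectivity of
      \<open>fst\<close> makes them as numerous as the edges, so \<open>E\<close> itself is the
      matching.\<close>
    moreover have "k \<le> card (fst ` E) + card ({} :: 'b set)"
      using psubset.hyps by (intro psubset.prems) (force simp: edge_cover_def)+
    ultimately show ?thesis
      by (metis add.right_neutral card.empty card_image order_refl)
  qed
qed

section \<open>Rank and sums of rank-one matrices\<close>

lemma row_in_span_rows_mult:
  fixes A :: "'a::field^'m^'p" and M :: "'a^'n^'m"
  shows "row i (A ** M) \<in> vec.span (rows M)"
proof -
  have "row i (A ** M) = (\<Sum>k\<in>UNIV. A $ i $ k *s row k M)"
    by (simp add: row_def matrix_matrix_mult_def vec_eq_iff)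
  also have "\<dots> \<in> vec.span (rows M)"
    by (intro vec.span_sum vec.span_scale vec.span_base) (auto simp: rows_def)
  finally show ?thesis .
qed

lemma rank_le_nrows:
  fixes A :: "'a::field^'n^'m"
  shows "rank A \<le> CARD('m)"
proof -
  have "rows A = (\<lambda>i. row i A) ` UNIV"
    by (auto simp: rows_def)
  then show ?thesis
    unfolding row_rank_def_gen
    by (metis card_image_le finite finite_imageI order_trans vec.dim_le_card')
qed

text \<open>Column \<open>i\<close> of \<open>X\<close> times row \<open>j\<close> of
  \<open>W\<close>. Taking \<open>W\<close> to be the transpose or the conjugate transpose of
  \<open>Y\<close> treats both fields at once.\<close>

definition outer :: "'a::field^'n^'m \<Rightarrow> 'a^'p^'q \<Rightarrow> 'n \<Rightarrow> 'q \<Rightarrow> 'a^'p^'m" where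
  "outer X W i j = (\<chi> a b. X $ a $ i * W $ j $ b)"

lemma mult_outer:
  fixes X' :: "'a::field^'m^'k"
  shows "X' ** outer X W i j = outer (X' ** X) W i j"
  by (simp add: outer_def matrix_matrix_mult_def vec_eq_iff sum_distrib_right mult.assoc)

lemma outer_mult:
  fixes W :: "'a::field^'p^'q"
  shows "outer X W i j ** W' = outer X (W ** W') i j"
  by (simp add: outer_def matrix_matrix_mult_def vec_eq_iff sum_distrib_left mult.assoc)

lemma outer_mat1:
  "outer (mat 1 :: 'a::field^'n^'n) (mat 1 :: 'a^'q^'q) i j $ k $ l = (if k = i \<and> l = j then 1 else 0)"
  by (auto simp: outer_def mat_def)

lemma matrix_mult_sum_right:
  fixes A :: "'a::field^'m^'p"
  shows "A ** (\<Sum>t\<in>T. f t) = (\<Sum>t\<in>T. A ** f t)"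
  by (induction T rule: infinite_finite_induct) (simp_all add: matrix_add_ldistrib)

lemma matrix_mult_add_left:
  fixes A B :: "'a::semiring_1^'m^'p"
  shows "(A + B) ** C = A ** C + B ** C"
  by (simp add: matrix_matrix_mult_def vec_eq_iff sum.distrib distrib_right)

text \<open>Left multiplication by \<open>X'\<close> isolates, for each edge \<open>(i, j)\<close>,
  row \<open>j\<close> of \<open>W\<close> as row \<open>i\<close> of the product. The row space of
  the sum thus contains \<open>card F\<close> distinct rows of an invertible matrix.\<close>

lemma rank_sum_outer_matching:
  fixes X X' :: "'a::field^'n^'n" and W W' :: "'a^'n^'n"
  assumes X: "X' ** X = mat 1" and W: "W ** W' = mat 1"
    and inj: "inj_on fst F" "inj_on snd F"
  shows "card F \<le> rank (\<Sum>(i, j)\<in>F. outer X W i j)" (is "_ \<le> rank ?M")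
proof -
  have row: "row j W \<in> vec.span (rows ?M)" if ij: "(i, j) \<in> F" for i j
  proof -
    have "row i (X' ** ?M) = row j W"
    proof -
      have "(X' ** ?M) $ i $ b = W $ j $ b" for b
      proof -
        have "(X' ** ?M) $ i $ b = (\<Sum>(i', j')\<in>F. outer (mat 1) W i' j' $ i $ b)"
          by (simp add: matrix_mult_sum_right mult_outer X case_prod_unfold)
        also have "\<dots> = (\<Sum>(i', j')\<in>F. if i' = i then W $ j' $ b else 0)"
          by (intro sum.cong) (auto simp: outer_def mat_def)
        \<comment> \<open>In a matching, \<open>(i, j)\<close> is the only edge with first
          coordinate \<open>i\<close>.\<close>
        also have "\<dots> = (\<Sum>t\<in>F. if t = (i, j) then W $ j $ b else 0)"
          using inj_onD[OF inj(1)] ij by (intro sum.cong) fastforce+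
        also have "\<dots> = W $ j $ b"
          using ij by simp
        finally show ?thesis .
      qed
      then show ?thesis
        by (simp add: row_def)
    qed
    then show ?thesis
      by (metis row_in_span_rows_mult)
  qed
  have span: "vec.span (rows W) = UNIV"
    using W matrix_left_right_inverse matrix_left_invertible_span_rows_gen by metis
  have rows: "rows W = (\<lambda>j. row j W) ` UNIV"
    by (auto simp: rows_def)
  \<comment> \<open>A spanning set has at least as many elements as the dimension, so the rows are
    pairwise distinct and form a basis.\<close>
  have "CARD('n) = card (rows W)"
  proof (rule antisym)
    have "vec.dim (UNIV :: ('a^'n) set) \<le> card (rows W)"
      using span by (intro vec.dim_le_card) (simp_all add: rows)
    then show "CARD('n) \<le> card (rows W)"
      by (simp add: card_cart_basis)
  qed (simp add: rows card_image_le)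
  then have inj_row: "inj (\<lambda>j. row j W)" and "vec.independent (rows W)"
    using span vec.card_le_dim_spanning[of "rows W" UNIV]
    by (simp_all add: rows eq_card_imp_inj_on card_cart_basis)
  then have "vec.independent ((\<lambda>j. row j W) ` snd ` F)"
    by (rule_tac vec.independent_mono) (auto simp: rows)
  then have "card ((\<lambda>j. row j W) ` snd ` F) \<le> vec.dim (vec.span (rows ?M))"
    using row by (intro vec.independent_card_le_dim) force+
  moreover have "card ((\<lambda>j. row j W) ` snd ` F) = card F"
    using inj(2) inj_row by (metis card_image inj_on_subset subset_UNIV)
  ultimately show ?thesis
    by (simp add: row_rank_def_gen)
qed

section \<open>From a small cover to a zero block\<close>

text \<open>Scalar multiplication is absent: a matching yields a member of \<open>S\<close> by
  addition alone, and \<open>supp\<close> carries all that is needed about the other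
  positions.\<close>

lemma zero_block_of_coordinate_support:
  fixes X X' W W' :: "'a::field^'n^'n" and S :: "('a^'n^'n) set"
  assumes X: "X' ** X = mat 1" and W: "W ** W' = mat 1"
    and zero: "0 \<in> S" and add: "\<And>M N. M \<in> S \<Longrightarrow> N \<in> S \<Longrightarrow> M + N \<in> S"
    and edge: "\<And>i j. (i, j) \<in> E \<Longrightarrow> outer X W i j \<in> S"
    and supp: "\<And>M i j. M \<in> S \<Longrightarrow> (i, j) \<notin> E \<Longrightarrow> (X' ** M ** W') $ i $ j = 0"
  shows "\<exists>I J. int (card I) + int (card J) = 2 * int CARD('n) - int (Max (rank ` S)) \<and>
    (\<forall>M\<in>S. \<forall>i\<in>I. \<forall>j\<in>J. (X' ** M ** W') $ i $ j = 0)"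
proof -
  define r where "r = Max (rank ` S)"
  \<comment> \<open>Boundedness of the ranks makes \<open>Max\<close> a genuine maximum.\<close>
  have "rank ` S \<subseteq> {..CARD('n)}"
    using rank_le_nrows by auto
  then have fin: "finite (rank ` S)"
    by (rule finite_subset) simp
  have "r \<le> CARD('n)"
    unfolding r_def using fin zero rank_le_nrows by (intro Max.boundedI) auto
  have "\<exists>C D. edge_cover E C D \<and> card C + card D \<le> r"
  proof (rule ccontr)
    assume "\<not> ?thesis"
    \<comment> \<open>If every cover has at least \<open>r + 1\<close> vertices, Koenig's theorem
      gives a matching too large for the maximal rank.\<close>
    then have "\<exists>F\<subseteq>E. inj_on fst F \<and> inj_on snd F \<and> Suc r \<le> card F"
      by (intro koenig_bipartite) (auto simp: not_le Suc_le_eq)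
    then obtain F where F: "F \<subseteq> E" "inj_on fst F" "inj_on snd F" "Suc r \<le> card F"
      by blast
    have "(\<Sum>(i, j)\<in>G. outer X W i j) \<in> S" if "G \<subseteq> E" for G
      using finite[of G] that by (induction G) (auto simp: zero intro: add edge)
    then have "rank (\<Sum>(i, j)\<in>F. outer X W i j) \<le> r"
      unfolding r_def using fin F(1) by (intro Max_ge) auto
    with rank_sum_outer_matching[OF X W F(2,3)] F(4) show False
      by simp
  qed
  then obtain C D where CD: "edge_cover E C D" "card C + card D \<le> r"
    by blast
  \<comment> \<open>Enlarging the row part of the cover to \<open>r - card D\<close> elements makes
    the block sizes sum to exactly \<open>2n - r\<close>; there is room because \<open>r\<close> is
    at most \<open>n\<close>.\<close>
  then obtain C' where C': "C \<subseteq> C'" "card C' = r - card D"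
    using exists_subset_between[of C "r - card D" UNIV] \<open>r \<le> CARD('n)\<close> CD(2) by fastforce
  have "card (- A) + card A = CARD('n)" for A :: "'n set"
    by (simp add: Compl_eq_Diff_UNIV card_Diff_subset card_mono)
  from this[of C'] this[of D] have "int (card (- C')) + int (card (- D)) = 2 * int CARD('n) - int r"
    using C'(2) CD(2) by linarith
  moreover have "(i, j) \<notin> E" if "i \<in> - C'" "j \<in> - D" for i j
    using CD(1) C'(1) that unfolding edge_cover_def by auto
  ultimately show ?thesis
    using supp unfolding r_def by blast
qed

text \<open>The scaling is a parameter, fixed only by its action on entries, so that real
  \<open>scaleR\<close> and complex \<open>cmat_scale\<close> are both instances.\<close>

lemma zero_block_of_span:
  fixes X X' W W' :: "'a::field^'n^'n" and scale :: "'a \<Rightarrow> 'a^'n^'n \<Rightarrow> 'a^'n^'n"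
  assumes scale: "\<And>c M i j. scale c M $ i $ j = c * M $ i $ j"
    and X: "X' ** X = mat 1" and W: "W ** W' = mat 1"
    and B: "B \<subseteq> {outer X W i j | i j. True}"
  defines "S \<equiv> module.span scale B"
  shows "\<exists>I J. int (card I) + int (card J) = 2 * int CARD('n) - int (Max (rank ` S)) \<and>
    (\<forall>M\<in>S. \<forall>i\<in>I. \<forall>j\<in>J. (X' ** M ** W') $ i $ j = 0)"
proof -
  interpret vector_space scale
    by unfold_locales (auto simp: scale vec_eq_iff algebra_simps)
  define E where "E = {(i, j). outer X W i j \<in> B}"
  have lin: "(X' ** (scale c M + N) ** W') $ i $ j =
      c * (X' ** M ** W') $ i $ j + (X' ** N ** W') $ i $ j" for c M N i j
  proof -
    have "X' ** scale c M ** W' = scale c (X' ** M ** W')"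
      by (simp add: vec_eq_iff matrix_matrix_mult_def scale sum_distrib_left sum_distrib_right
          mult.assoc mult.left_commute)
    then show ?thesis
      by (simp add: matrix_add_ldistrib matrix_mult_add_left scale)
  qed
  show ?thesis
  proof (rule zero_block_of_coordinate_support[OF X W, where E = E])
    fix M i j assume "M \<in> S" and ij: "(i, j) \<notin> E"
    from this(1) show "(X' ** M ** W') $ i $ j = 0"
      unfolding S_def
    proof (induction rule: span_induct_alt)
      case base
      show ?case by simp
    next
      case (step c b N)
      \<comment> \<open>The generator becomes the matrix unit at \<open>(k, l)\<close>, a position
        in \<open>E\<close> and hence different from \<open>(i, j)\<close>.\<close>
      from step(1) B obtain k l where "b = outer X W k l" by blast
      with step(1) ij have "(X' ** b ** W') $ i $ j = 0"
        by (auto simp: E_def mult_outer outer_mult X W outer_mat1)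
      with step(2) show ?case by (simp add: lin)
    qed
  qed (auto simp: S_def E_def intro: span_zero span_add span_base)
qed

section \<open>Specialization to the real and complex fields\<close>

lemma columnvector_mult_transpose:
  "columnvector (column i X) ** transpose (columnvector (column j Y) :: 'a::field^1^'n) =
    outer X (transpose Y) i j"
  by (simp add: vec_eq_iff matrix_matrix_mult_def columnvector_def transpose_def column_def outer_def)

lemma columnvector_mult_conj_transpose:
  "columnvector (column i X) ** conj_transpose (columnvector (column j Y) :: complex^1^'n) =
    outer X (conj_transpose Y) i j"
  by (simp add: vec_eq_iff matrix_matrix_mult_def columnvector_def transpose_def column_def outer_def
      conj_transpose_def map_matrix_def)

lemma conj_transpose_mult: "conj_transpose (A ** B) = conj_transpose B ** conj_transpose A"
  by (simp add: vec_eq_iff matrix_matrix_mult_def transpose_def conj_transpose_def map_matrix_def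
      mult.commute)

lemma conj_transpose_mat1: "conj_transpose (mat 1) = mat 1"
  by (auto simp: vec_eq_iff mat_def transpose_def conj_transpose_def map_matrix_def)

lemma matrix_inv_left:
  fixes A :: "'a::semiring_1^'n^'m"
  assumes "invertible A"
  shows "matrix_inv A ** A = mat 1"
  using assms unfolding invertible_def matrix_inv_def by (rule someI2_ex) simp

theorem proposition2p9:
  assumes "CARD('n::finite) \<ge> 2"
  shows
    "(\<forall>(X::real^'n^'n) (Y::real^'n^'n) (S::(real^'n^'n) set) (B::(real^'n^'n) set) (r::nat).
        invertible X \<and> invertible Y \<and>
        subspace S \<and>
        B \<subseteq> {columnvector (column i X) ** transpose (columnvector (column j Y) :: real^1^'n) | i j. True} \<and>
        independent B \<and> span B = S \<and>
        Max (rank ` S) = r \<longrightarrow>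
        (\<exists>(I::'n set) (J::'n set). int (card I) + int (card J) = 2 * int CARD('n) - int r \<and>
           (\<forall>M\<in>S. \<forall>i\<in>I. \<forall>j\<in>J. (matrix_inv X ** M ** transpose (matrix_inv Y)) $ i $ j = 0))) \<and>
     (\<forall>(X::complex^'n^'n) (Y::complex^'n^'n) (S::(complex^'n^'n) set) (B::(complex^'n^'n) set) (r::nat).
        invertible X \<and> invertible Y \<and>
        cmat.subspace S \<and>
        B \<subseteq> {columnvector (column i X) ** conj_transpose (columnvector (column j Y) :: complex^1^'n) | i j. True} \<and>
        cmat.independent B \<and> cmat.span B = S \<and>
        Max (rank ` S) = r \<longrightarrow>
        (\<exists>(I::'n set) (J::'n set). int (card I) + int (card J) = 2 * int CARD('n) - int r \<and>
           (\<forall>M\<in>S. \<forall>i\<in>I. \<forall>j\<in>J. (matrix_inv X ** M ** conj_transpose (matrix_inv Y)) $ i $ j = 0)))"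
proof (intro conjI allI impI; elim conjE)
  fix X Y :: "real^'n^'n" and S B and r :: nat
  assume inv: "invertible X" "invertible Y" and S: "span B = S" and r: "Max (rank ` S) = r"
    and B: "B \<subseteq> {columnvector (column i X) ** transpose (columnvector (column j Y) :: real^1^'n) | i j. True}"
  \<comment> \<open>Transposing \<open>matrix_inv Y ** Y = mat 1\<close> supplies the pair
    \<open>W\<close>, \<open>W'\<close>.\<close>
  have "transpose Y ** transpose (matrix_inv Y) = mat 1"
    using inv(2) by (simp add: matrix_inv_left flip: matrix_transpose_mul)
  from zero_block_of_span[of scaleR, OF _ matrix_inv_left[OF inv(1)] this,
      OF _ B[unfolded columnvector_mult_transpose]]
  show "\<exists>(I::'n set) (J::'n set). int (card I) + int (card J) = 2 * int CARD('n) - int r \<and>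
      (\<forall>M\<in>S. \<forall>i\<in>I. \<forall>j\<in>J. (matrix_inv X ** M ** transpose (matrix_inv Y)) $ i $ j = 0)"
    by (simp add: S r flip: span_raw_def)
next
  fix X Y :: "complex^'n^'n" and S B and r :: nat
  assume inv: "invertible X" "invertible Y" and S: "cmat.span B = S" and r: "Max (rank ` S) = r"
    and B: "B \<subseteq> {columnvector (column i X) ** conj_transpose (columnvector (column j Y) :: complex^1^'n) | i j. True}"
  have "conj_transpose Y ** conj_transpose (matrix_inv Y) = mat 1"
    using inv(2) by (simp add: matrix_inv_left conj_transpose_mat1 flip: conj_transpose_mult)
  from zero_block_of_span[of cmat_scale, OF _ matrix_inv_left[OF inv(1)] this,
      OF _ B[unfolded columnvector_mult_conj_transpose]]
  show "\<exists>(I::'n set) (J::'n set). int (card I) + int (card J) = 2 * int CARD('n) - int r \<and>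
      (\<forall>M\<in>S. \<forall>i\<in>I. \<forall>j\<in>J. (matrix_inv X ** M ** conj_transpose (matrix_inv Y)) $ i $ j = 0)"
    by (simp add: S r cmat_scale_def map_matrix_def)
qed

end
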